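(* Let $A$ be a Banach function algebra and let $E\subseteq M(A)$ be a $t$-analytic set for $A$ such that $E$ has at least two points. Then $E\cap \mathscr R_I=\emptyset$ and $E\cap \mathscr R_{II}=\emptyset$, where $\mathscr R_I$ and $\mathscr R_{II}$ are the sets of regularity points of type one and of type two for $A$, respectively. In particular, if $A$ is regular, then the only non-empty $t$-analytic sets for $A$ are singletons.
   Context: A Banach function algebra $A$ is a commutative, unital, semisimple complex Banach algebra, regarded via the Gelfand transform as an algebra of continuous functions on its character space $M(A)$ (the compact Hausdorff space of non-zero multiplicative linear functionals on $A$ with the Gelfand, i.e. weak-$*$, topology). A set $E\subseteq M(A)$ is a $t$-analytic set for $A$ if for every $f\in A$ and every non-empty relatively open subset $U$ of $E$, $f\equiv 0$ on $U$ implies $f\equiv 0$ on $E$. For $f\in A$, $\operatorname{supp} f=\overline{\{x\in M(A): f(x)\neq 0\}}$. A point $x\in M(A)$ is a regularity point of type one if for every neighborhood $V$ of $x$ in $M(A)$ there is $f\in A$ with $f(x)=1$ and $\operatorname{supp} f\subseteq V$. For $x\in M(A)$ let $J_A(x)$ be the ideal of all $f\in A$ that vanish in a neighborhood of $x$ in $M(A)$, and let $k_A(x)=\{y\in M(A): f(y)=0\text{ for all }f\in J_A(x)\}$; $x$ is a regularity point of type two if $k_A(x)=\{x\}$. $A$ is regular if for all $x\in M(A)$ and all closed sets $F\subseteq M(A)\setminus\{x\}$ there is $f\in A$ with $f\equiv 1$ on $F$ and $f(x)=0$. *)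

theory Defs
  imports "HOL-Analysis.Analysis"
begin

text \<open>
  The type classes provide a commutative unital real Banach algebra with \<open>1 \<noteq> 0\<close>; the locale adds
  the complex scalar multiplication extending the real one. The normalisation \<open>norm 1 = 1\<close> is not
  required (it can always be achieved by passing to an equivalent norm).
\<close>

locale complex_banach_algebra = vector_space scaleC
  for scaleC :: "complex \<Rightarrow> 'a \<Rightarrow> 'a::{comm_ring_1, real_normed_algebra, banach}" +
  assumes scaleC_of_real: "scaleC (of_real r) a = r *\<^sub>R a"
    and scaleC_mult_left: "scaleC c a * b = scaleC c (a * b)"
    and norm_scaleC: "norm (scaleC c a) = norm c * norm a"

text \<open>Ideals of a commutative ring are the submodules of the ring regarded as a module over itself.\<close>

definition ring_ideal :: "'a::comm_ring_1 set \<Rightarrow> bool" where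
  "ring_ideal I \<longleftrightarrow> module.subspace (*) I"

definition maximal_ideal :: "'a::comm_ring_1 set \<Rightarrow> bool" where
  "maximal_ideal I \<longleftrightarrow>
     ring_ideal I \<and> I \<noteq> UNIV \<and> (\<forall>J. ring_ideal J \<and> I \<subseteq> J \<longrightarrow> J = I \<or> J = UNIV)"

definition jacobson_radical :: "'a::comm_ring_1 set" where
  "jacobson_radical = \<Inter> {I. maximal_ideal I}"

locale banach_function_algebra = complex_banach_algebra scaleC
  for scaleC :: "complex \<Rightarrow> 'a \<Rightarrow> 'a::{comm_ring_1, real_normed_algebra, banach}" +
  assumes semisimple: "(jacobson_radical :: 'a set) = {0}"

definition character_set :: "(complex \<Rightarrow> 'a \<Rightarrow> 'a::comm_ring_1) \<Rightarrow> ('a \<Rightarrow> complex) set" where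
  "character_set scaleC =
     {x. Vector_Spaces.linear scaleC (*) x \<and> (\<forall>a b. x (a * b) = x a * x b) \<and> (\<exists>a. x a \<noteq> 0)}"

text \<open>
  The weak-* topology is the topology of pointwise convergence on the algebra, i.e. the subspace
  topology inherited from the product of copies of the complex plane indexed by the algebra.
\<close>

definition gelfand_topology :: "(complex \<Rightarrow> 'a \<Rightarrow> 'a::comm_ring_1) \<Rightarrow> ('a \<Rightarrow> complex) topology" where
  "gelfand_topology scaleC =
     subtopology (product_topology (\<lambda>_. euclidean) UNIV) (character_set scaleC)"

text \<open>The value at the point \<open>x\<close> of the function that represents the algebra element \<open>f\<close>.\<close>

definition gelfand :: "'a \<Rightarrow> ('a \<Rightarrow> complex) \<Rightarrow> complex" where
  "gelfand f x = x f"

lemma topspace_gelfand_topology: "topspace (gelfand_topology scaleC) = character_set scaleC"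
  by (simp add: gelfand_topology_def)

lemma Hausdorff_gelfand_topology: "Hausdorff_space (gelfand_topology scaleC)"
  by (simp add: gelfand_topology_def Hausdorff_space_subtopology Hausdorff_space_product_topology)

lemma continuous_map_gelfand: "continuous_map (gelfand_topology scaleC) euclidean (gelfand f)"
  unfolding gelfand_topology_def gelfand_def
  by (intro continuous_map_from_subtopology continuous_map_product_projection) simp

definition t_analytic ::
    "(complex \<Rightarrow> 'a \<Rightarrow> 'a::comm_ring_1) \<Rightarrow> ('a \<Rightarrow> complex) set \<Rightarrow> bool" where
  "t_analytic scaleC E \<longleftrightarrow>
     E \<subseteq> character_set scaleC \<and>
     (\<forall>f U. openin (subtopology (gelfand_topology scaleC) E) U \<and> U \<noteq> {} \<and> (\<forall>x\<in>U. gelfand f x = 0)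
        \<longrightarrow> (\<forall>x\<in>E. gelfand f x = 0))"

definition gelfand_supp ::
    "(complex \<Rightarrow> 'a \<Rightarrow> 'a::comm_ring_1) \<Rightarrow> 'a \<Rightarrow> ('a \<Rightarrow> complex) set" where
  "gelfand_supp scaleC f =
     gelfand_topology scaleC closure_of {x \<in> character_set scaleC. gelfand f x \<noteq> 0}"

text \<open>Neighbourhoods need not be open.\<close>

definition char_nhd ::
    "(complex \<Rightarrow> 'a \<Rightarrow> 'a::comm_ring_1) \<Rightarrow> ('a \<Rightarrow> complex) \<Rightarrow> ('a \<Rightarrow> complex) set \<Rightarrow> bool" where
  "char_nhd scaleC x V \<longleftrightarrow>
     V \<subseteq> character_set scaleC \<and> x \<in> gelfand_topology scaleC interior_of V"

definition regularity_points_I ::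
    "(complex \<Rightarrow> 'a \<Rightarrow> 'a::comm_ring_1) \<Rightarrow> ('a \<Rightarrow> complex) set" where
  "regularity_points_I scaleC =
     {x \<in> character_set scaleC.
        \<forall>V. char_nhd scaleC x V \<longrightarrow> (\<exists>f. gelfand f x = 1 \<and> gelfand_supp scaleC f \<subseteq> V)}"

definition J_ideal ::
    "(complex \<Rightarrow> 'a \<Rightarrow> 'a::comm_ring_1) \<Rightarrow> ('a \<Rightarrow> complex) \<Rightarrow> 'a set" where
  "J_ideal scaleC x = {f. \<exists>V. char_nhd scaleC x V \<and> (\<forall>y\<in>V. gelfand f y = 0)}"

definition k_hull ::
    "(complex \<Rightarrow> 'a \<Rightarrow> 'a::comm_ring_1) \<Rightarrow> ('a \<Rightarrow> complex) \<Rightarrow> ('a \<Rightarrow> complex) set" where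
  "k_hull scaleC x = {y \<in> character_set scaleC. \<forall>f \<in> J_ideal scaleC x. gelfand f y = 0}"

definition regularity_points_II ::
    "(complex \<Rightarrow> 'a \<Rightarrow> 'a::comm_ring_1) \<Rightarrow> ('a \<Rightarrow> complex) set" where
  "regularity_points_II scaleC = {x \<in> character_set scaleC. k_hull scaleC x = {x}}"

definition regular_algebra :: "(complex \<Rightarrow> 'a \<Rightarrow> 'a::comm_ring_1) \<Rightarrow> bool" where
  "regular_algebra scaleC \<longleftrightarrow>
     (\<forall>x \<in> character_set scaleC. \<forall>F. closedin (gelfand_topology scaleC) F \<and> x \<notin> F
        \<longrightarrow> (\<exists>f. (\<forall>y\<in>F. gelfand f y = 1) \<and> gelfand f x = 0))"

end

theory Submission
  imports Defs
begin

text \<open>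
  If \<open>x\<close> lies in a \<open>t\<close>-analytic set \<open>E\<close>, then every \<open>f \<in> J(x)\<close> vanishes on a non-empty relatively
  open subset of \<open>E\<close>, hence on \<open>E\<close>; thus \<open>E \<subseteq> k(x)\<close>. This rules out points of type two. Points of
  type one are ruled out because such a point lies outside \<open>k(y)\<close> for all \<open>y \<noteq> x\<close>. In a
  regular algebra all points are of type two.
\<close>

lemma t_analytic_subset_k_hull:
  assumes E: "t_analytic scaleC E" and x: "x \<in> E"
  shows "E \<subseteq> k_hull scaleC x"
proof
  fix y assume y: "y \<in> E"
  have "gelfand f y = 0" if f: "f \<in> J_ideal scaleC x" for f
  proof -
    obtain V where V: "char_nhd scaleC x V" "\<forall>z\<in>V. gelfand f z = 0"
      using f unfolding J_ideal_def by blast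
    \<comment> \<open>Neighbourhoods need not be open, so the interior of \<open>V\<close> is cut
      with \<open>E\<close>; \<open>x\<close> itself witnesses that the result is non-empty.\<close>
    let ?U = "E \<inter> gelfand_topology scaleC interior_of V"
    have "openin (subtopology (gelfand_topology scaleC) E) ?U"
      by (simp add: openin_subtopology_Int2)
    moreover have "?U \<noteq> {}"
      using V(1) x unfolding char_nhd_def by blast
    moreover have "\<forall>z\<in>?U. gelfand f z = 0"
      using V(2) interior_of_subset[of "gelfand_topology scaleC" V] by blast
    ultimately show ?thesis
      using E y unfolding t_analytic_def by blast
  qed
  then show "y \<in> k_hull scaleC x"
    using E y unfolding k_hull_def t_analytic_def by blast
qed

lemma char_nhd_open:
  assumes "openin (gelfand_topology scaleC) U" "x \<in> U"
  shows "char_nhd scaleC x U"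
  using assms openin_subset[OF assms(1)]
  by (simp add: char_nhd_def interior_of_openin topspace_gelfand_topology)

lemma separate_characters:
  assumes "x \<in> character_set scaleC" "y \<in> character_set scaleC" "x \<noteq> y"
  obtains U V where "openin (gelfand_topology scaleC) U" "openin (gelfand_topology scaleC) V"
    "x \<in> U" "y \<in> V" "U \<inter> V = {}"
proof -
  have "\<exists>U V. openin (gelfand_topology scaleC) U \<and> openin (gelfand_topology scaleC) V \<and>
      x \<in> U \<and> y \<in> V \<and> disjnt U V"
    using Hausdorff_gelfand_topology[of scaleC] assms
    unfolding Hausdorff_space_def topspace_gelfand_topology by blast
  then show ?thesis
    using that unfolding disjnt_def by blast
qed

text \<open>Separate \<open>x\<close> and \<open>y\<close> by disjoint open sets: a function that is
  1 at \<open>x\<close> and supported on the side of \<open>x\<close> vanishes near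
  \<open>y\<close>, so it lies in J(y) and excludes \<open>x\<close> from the hull.\<close>

lemma regularity_point_I_notin_k_hull:
  assumes x: "x \<in> regularity_points_I scaleC" and y: "y \<in> character_set scaleC" and ne: "x \<noteq> y"
  shows "x \<notin> k_hull scaleC y"
proof -
  have "x \<in> character_set scaleC"
    using x unfolding regularity_points_I_def by blast
  then obtain U V where UV: "openin (gelfand_topology scaleC) U" "openin (gelfand_topology scaleC) V"
    "x \<in> U" "y \<in> V" "U \<inter> V = {}"
    using separate_characters y ne by blast
  obtain f where f: "gelfand f x = 1" "gelfand_supp scaleC f \<subseteq> U"
    using x char_nhd_open[OF UV(1,3)] unfolding regularity_points_I_def by blast
  have "{z \<in> character_set scaleC. gelfand f z \<noteq> 0} \<subseteq> gelfand_supp scaleC f"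
    unfolding gelfand_supp_def by (rule closure_of_subset) (auto simp: topspace_gelfand_topology)
  moreover have "V \<subseteq> character_set scaleC"
    using openin_subset[OF UV(2)] by (simp add: topspace_gelfand_topology)
  ultimately have "\<forall>z\<in>V. gelfand f z = 0"
    using f(2) UV(5) by blast
  then have "f \<in> J_ideal scaleC y"
    using char_nhd_open[OF UV(2,4)] unfolding J_ideal_def by blast
  then show ?thesis
    using f(1) unfolding k_hull_def by force
qed

text \<open>A character is multiplicative and non-zero, so cancelling a non-zero value
  \<open>x a\<close> forces \<open>x 1 = 1\<close>. This lets \<open>1 - f\<close> exchange the
  values 0 and 1.\<close>

lemma character_one_diff:
  assumes "x \<in> character_set scaleC"
  shows "x (1 - f) = 1 - x f"
proof -
  interpret Vector_Spaces.linear scaleC "(*)" x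
    using assms unfolding character_set_def by blast
  obtain a where a: "x a \<noteq> 0"
    using assms unfolding character_set_def by blast
  have "x (a * 1) = x a * x 1"
    using assms unfolding character_set_def by blast
  then have "x 1 = 1"
    using a by simp
  then show ?thesis
    by (simp only: diff)
qed

text \<open>To exclude \<open>y\<close> from the hull of \<open>x\<close> one needs a function that
  vanishes near \<open>x\<close> but not at \<open>y\<close>. Regularity at \<open>y\<close> gives
  one that is 1 near \<open>x\<close> and 0 at \<open>y\<close>; its complement \<open>1 - f\<close>
  serves.\<close>

lemma regular_algebra_regularity_points_II:
  assumes reg: "regular_algebra scaleC"
  shows "regularity_points_II scaleC = character_set scaleC"
proof -
  have "k_hull scaleC x = {x}" if x: "x \<in> character_set scaleC" for x
  proof -
    have "y \<notin> k_hull scaleC x" if y: "y \<in> character_set scaleC" and ne: "y \<noteq> x" for y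
    proof -
      obtain U V where UV: "openin (gelfand_topology scaleC) U" "openin (gelfand_topology scaleC) V"
        "y \<in> U" "x \<in> V" "U \<inter> V = {}"
        using separate_characters y x ne by blast
      have V: "V \<subseteq> character_set scaleC - U"
        using openin_subset[OF UV(2)] UV(5) by (auto simp: topspace_gelfand_topology)
      \<comment> \<open>The closed set is the complement of \<open>U\<close> rather than
        \<open>{x}\<close>: it contains the neighbourhood \<open>V\<close> of \<open>x\<close>, so
        \<open>1 - f\<close> vanishes near \<open>x\<close> and not merely at
        \<open>x\<close>.\<close>
      have "closedin (gelfand_topology scaleC) (character_set scaleC - U)"
        using UV(1) by (metis closedin_diff closedin_topspace topspace_gelfand_topology)
      then obtain f where f: "\<forall>z\<in>character_set scaleC - U. gelfand f z = 1" "gelfand f y = 0"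
        using reg y UV(3) unfolding regular_algebra_def by blast
      have "\<forall>z\<in>V. gelfand (1 - f) z = 0"
      proof
        fix z assume "z \<in> V"
        then have "z \<in> character_set scaleC" "gelfand f z = 1"
          using V f(1) by blast+
        then show "gelfand (1 - f) z = 0"
          using character_one_diff[of z scaleC f] by (simp add: gelfand_def)
      qed
      then have "1 - f \<in> J_ideal scaleC x"
        using char_nhd_open[OF UV(2,4)] unfolding J_ideal_def by blast
      moreover have "gelfand (1 - f) y = 1"
        using f(2) character_one_diff[OF y] by (simp add: gelfand_def)
      ultimately show ?thesis
        unfolding k_hull_def by force
    qed
    moreover have "x \<in> k_hull scaleC x"
      using x interior_of_subset[of "gelfand_topology scaleC"]
      unfolding k_hull_def J_ideal_def char_nhd_def by blast
    ultimately show ?thesis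
      unfolding k_hull_def by blast
  qed
  then show ?thesis
    unfolding regularity_points_II_def by blast
qed

text \<open>The only non-empty subset of a singleton is the singleton itself.\<close>

lemma t_analytic_singleton:
  assumes "x \<in> character_set scaleC"
  shows "t_analytic scaleC {x}"
proof -
  have "x \<in> U" if "openin (subtopology (gelfand_topology scaleC) {x}) U" "U \<noteq> {}" for U
    using openin_imp_subset[OF that(1)] that(2) by blast
  then show ?thesis
    using assms unfolding t_analytic_def by blast
qed

lemma t_analytic_no_regularity_points:
  assumes E: "t_analytic scaleC E" and "x \<in> E" "y \<in> E" "x \<noteq> y"
  shows "E \<inter> regularity_points_I scaleC = {}" "E \<inter> regularity_points_II scaleC = {}"
proof -
  \<comment> \<open>Of two distinct points, at least one differs from any given
    \<open>z\<close>.\<close>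
  have other: "\<exists>w\<in>E. w \<noteq> z" for z
    using assms by metis
  show "E \<inter> regularity_points_I scaleC = {}"
  proof (rule ccontr)
    assume "E \<inter> regularity_points_I scaleC \<noteq> {}"
    then obtain z where z: "z \<in> E" "z \<in> regularity_points_I scaleC" by blast
    \<comment> \<open>For type one the hull is taken at the other point \<open>w\<close>:
      t-analyticity puts \<open>z\<close> into k(w), which a point of type one avoids.\<close>
    obtain w where w: "w \<in> E" "w \<noteq> z" using other by blast
    have "z \<notin> k_hull scaleC w"
      using z w E regularity_point_I_notin_k_hull unfolding t_analytic_def by blast
    then show False
      using t_analytic_subset_k_hull[OF E w(1)] z(1) by blast
  qed
  \<comment> \<open>For type two the hull is taken at the point \<open>z\<close> itself:
    \<open>E\<close> would lie in k(z), which is \<open>{z}\<close>, although \<open>E\<close> has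
    another point.\<close>
  show "E \<inter> regularity_points_II scaleC = {}"
    using other t_analytic_subset_k_hull[OF E] unfolding regularity_points_II_def by blast
qed

theorem proposition4p5:
  fixes scaleC :: "complex \<Rightarrow> 'a \<Rightarrow> 'a::{comm_ring_1, real_normed_algebra, banach}"
  assumes "banach_function_algebra scaleC"
  shows "(\<forall>E. t_analytic scaleC E \<and> (\<exists>x\<in>E. \<exists>y\<in>E. x \<noteq> y) \<longrightarrow>
            E \<inter> regularity_points_I scaleC = {} \<and> E \<inter> regularity_points_II scaleC = {}) \<and>
         (regular_algebra scaleC \<longrightarrow>
            (\<forall>E. E \<noteq> {} \<longrightarrow>
               (t_analytic scaleC E \<longleftrightarrow> (\<exists>x \<in> character_set scaleC. E = {x}))))"
proof (intro conjI allI impI)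
  fix E
  assume "t_analytic scaleC E \<and> (\<exists>x\<in>E. \<exists>y\<in>E. x \<noteq> y)"
  then obtain x y where xy: "t_analytic scaleC E" "x \<in> E" "y \<in> E" "x \<noteq> y"
    by blast
  show "E \<inter> regularity_points_I scaleC = {}" "E \<inter> regularity_points_II scaleC = {}"
    using t_analytic_no_regularity_points[OF xy] .
next
  fix E :: "('a \<Rightarrow> complex) set"
  assume reg: "regular_algebra scaleC" and "E \<noteq> {}"
  then obtain x where x: "x \<in> E" by blast
  show "t_analytic scaleC E \<longleftrightarrow> (\<exists>x \<in> character_set scaleC. E = {x})"
  proof
    assume E: "t_analytic scaleC E"
    then have xc: "x \<in> character_set scaleC"
      using x unfolding t_analytic_def by blast
    have "y = x" if "y \<in> E" for y
    proof (rule ccontr)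
      assume "y \<noteq> x"
      \<comment> \<open>A second point would keep \<open>E\<close> away from the points of type two,
        which by regularity are all the characters, \<open>x\<close> included.\<close>
      then have "E \<inter> regularity_points_II scaleC = {}"
        using t_analytic_no_regularity_points(2)[OF E x that] by simp
      then show False
        using x xc regular_algebra_regularity_points_II[OF reg] by blast
    qed
    then show "\<exists>x \<in> character_set scaleC. E = {x}"
      using x xc by blast
  next
    assume "\<exists>x \<in> character_set scaleC. E = {x}"
    then show "t_analytic scaleC E"
      using t_analytic_singleton by blast
  qed
qed

end
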